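(* Let $k$ be an algebraically closed field of characteristic $2$, let $\Sigma_3\subset\mathbb{P}^4$ be the Segre cubic primal, and let $\phi:\mathbb{P}^3\dashrightarrow\Sigma_3\subset\mathbb{P}^4$ be its rational parameterization by quadrics through the five reference points $p_1,\ldots,p_5$. Let $x\in\Sigma_3$ be a nonsingular point such that $p_6=\phi^{-1}(x)$ is a well-defined point of $\mathbb{P}^3$ not lying in any plane spanned by three of the points $p_1,\ldots,p_5$, and let $Q_x$ be the polar quadric of $\Sigma_3$ with pole at $x$. Then the pre-image of $Q_x$ under the map $\phi:\mathbb{P}^3\dashrightarrow\mathbb{P}^4$ is isomorphic to the Weddle surface associated with the six points $p_1,\ldots,p_5,p_6=\phi^{-1}(x)$.
   Context: Reference points in $\mathbb{P}^3$: $p_1=[1,0,0,0]$, $p_2=[0,1,0,0]$, $p_3=[0,0,1,0]$, $p_4=[0,0,0,1]$, $p_5=[1,1,1,1]$. Segre cubic primal $\Sigma_3\subset\mathbb{P}^4$: the cubic hypersurface with ten ordinary nodes given by $F=0$, where $$F=x_1x_2x_4-x_0x_3x_4-x_1x_2x_3+x_0x_1x_3+x_0x_2x_3-x_0^2x_3 .$$ The map $\phi$ is the birational map $\mathbb{P}^3\dashrightarrow\Sigma_3$ given by $$[x_0,x_1,x_2,x_3,x_4]=[t_3(t_0+t_1),\,t_3(t_1+t_2),\,t_2(t_0+t_1),\,t_2(t_1+t_3),\,(t_0+t_2)(t_1+t_3)];$$ its components span the space of quadratic forms vanishing at $p_1,\ldots,p_5$. The point $\phi^{-1}(x)$ is the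 image of $x$ under the inverse rational map. The polar quadric of $\Sigma_3$ with pole $x=[\xi_0,\ldots,\xi_4]$ is $Q_x=V\bigl(\sum_{i=0}^4\xi_i\,\partial F/\partial x_i\bigr)$. The pre-image of $Q_x$ under $\phi$ is the quartic surface in $\mathbb{P}^3$ obtained by substituting the quadratic forms defining $\phi$ into the equation of $Q_x$. Weddle surface associated with $p_1,\ldots,p_5$ and $p_6=[a,b,c,d]$: the quartic surface in $\mathbb{P}^3$ with coordinates $[x,y,z,w]$ given by $$\det\begin{pmatrix}ayzw&x&1&a\\ bxzw&y&1&b\\ cxyw&z&1&c\\ dxyz&w&1&d\end{pmatrix}=0 .$$ *)

theory Defs
  imports
    "HOL-Analysis.Determinants"
    "HOL-Library.Poly_Mapping"
    "HOL-Library.Numeral_Type"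
    "HOL-Computational_Algebra.Polynomial"
begin

section \<open>Polynomials in the variables indexed by a finite type\<close>

text \<open>
  The homogeneous coordinate ring of projective n-space over \<open>'a\<close> is the type
  \<open>('a, 'v) mpol\<close> with \<open>CARD('v) = n + 1\<close>. For the index types \<open>4\<close> and \<open>5\<close> the coordinates are
  numbered from 0, as in \<open>[t\<^sub>0, \<dots>, t\<^sub>3]\<close> and \<open>[x\<^sub>0, \<dots>, x\<^sub>4]\<close>.
  Points of projective space are given by nonzero coordinate vectors.
\<close>

type_synonym ('a, 'v) mpol = "('v \<Rightarrow>\<^sub>0 nat) \<Rightarrow>\<^sub>0 'a"

definition Var :: "'v \<Rightarrow> ('a::comm_ring_1, 'v) mpol" where
  "Var v = Poly_Mapping.single (Poly_Mapping.single v 1) 1"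

definition Const :: "'a::comm_ring_1 \<Rightarrow> ('a, 'v) mpol" where
  "Const c = Poly_Mapping.single 0 c"

definition eval_pol :: "'a ^ 'v \<Rightarrow> ('a::comm_ring_1, 'v::finite) mpol \<Rightarrow> 'a" where
  "eval_pol x p =
     (\<Sum>m\<in>Poly_Mapping.keys p.
        Poly_Mapping.lookup p m * (\<Prod>v\<in>UNIV. (x $ v) ^ Poly_Mapping.lookup m v))"

definition subst_pol ::
  "('a, 'v) mpol ^ 'w \<Rightarrow> ('a::comm_ring_1, 'w::finite) mpol \<Rightarrow> ('a, 'v) mpol" where
  "subst_pol f p =
     (\<Sum>m\<in>Poly_Mapping.keys p.
        Const (Poly_Mapping.lookup p m) * (\<Prod>w\<in>UNIV. (f $ w) ^ Poly_Mapping.lookup m w))"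

definition partial_deriv :: "'v \<Rightarrow> ('a::comm_ring_1, 'v) mpol \<Rightarrow> ('a, 'v) mpol" where
  "partial_deriv v p =
     (\<Sum>m\<in>Poly_Mapping.keys p.
        Poly_Mapping.single (m - Poly_Mapping.single v 1)
          (of_nat (Poly_Mapping.lookup m v) * Poly_Mapping.lookup p m))"

definition homogeneous :: "nat \<Rightarrow> ('a::comm_ring_1, 'v::finite) mpol \<Rightarrow> bool" where
  "homogeneous d p \<longleftrightarrow>
     (\<forall>m\<in>Poly_Mapping.keys p. (\<Sum>v\<in>UNIV. Poly_Mapping.lookup m v) = d)"

definition homogeneous_tuple :: "('a::comm_ring_1, 'v::finite) mpol ^ 'w \<Rightarrow> bool" where
  "homogeneous_tuple f \<longleftrightarrow> (\<exists>d. \<forall>w. homogeneous d (f $ w))"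


section \<open>Projective hypersurfaces\<close>

definition nonsingular_point :: "('a::field, 'v::finite) mpol \<Rightarrow> 'a ^ 'v \<Rightarrow> bool" where
  "nonsingular_point F x \<longleftrightarrow>
     x \<noteq> 0 \<and> eval_pol x F = 0 \<and> (\<exists>v. eval_pol x (partial_deriv v F) \<noteq> 0)"

definition polar :: "('a::field, 'v::finite) mpol \<Rightarrow> 'a ^ 'v \<Rightarrow> ('a, 'v) mpol" where
  "polar F \<xi> = (\<Sum>v\<in>UNIV. Const (\<xi> $ v) * partial_deriv v F)"

text \<open>
  Let \<open>X = V(F)\<close> and \<open>Y = V(G)\<close> be hypersurfaces, as closed subschemes of projective spaces over an
  algebraically closed field. A morphism from X to Y is given by a set \<open>M\<close> of tuples \<open>f\<close>
  of forms of equal degree: \<open>f\<close> describes the morphism on the open subscheme of X where some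
  \<open>f\<^sub>k\<close> is invertible. These open sets have to cover X (closed points suffice), the values have to lie in Y,
  and two tuples have to agree where both are defined. In at least two variables, a form s vanishes on the open subscheme
  of X where the form h is invertible iff \<open>F\<close> divides \<open>h ^ N * s\<close> for some \<open>N\<close>; so all
  identities are scheme-theoretic, and X and Y need not be reduced.
\<close>

definition vanishes_where ::
  "('a::field, 'v) mpol \<Rightarrow> ('a, 'v) mpol \<Rightarrow> ('a, 'v) mpol \<Rightarrow> bool" where
  "vanishes_where F h s \<longleftrightarrow> (\<exists>N. F dvd h ^ N * s)"

definition hypersurface_morphism ::
  "('a::field, 'v::finite) mpol \<Rightarrow> ('a, 'w::finite) mpol \<Rightarrow> (('a, 'v) mpol ^ 'w) set \<Rightarrow> bool" where
  "hypersurface_morphism F G M \<longleftrightarrow>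
     (\<forall>f\<in>M. homogeneous_tuple f) \<and>
     (\<forall>x. x \<noteq> 0 \<and> eval_pol x F = 0 \<longrightarrow> (\<exists>f\<in>M. \<exists>k. eval_pol x (f $ k) \<noteq> 0)) \<and>
     (\<forall>f\<in>M. \<forall>k. vanishes_where F (f $ k) (subst_pol f G)) \<and>
     (\<forall>f\<in>M. \<forall>f'\<in>M. \<forall>k l i j.
        vanishes_where F (f $ k * f' $ l) (f $ i * f' $ j - f $ j * f' $ i))"

text \<open>The composite of N after M is the identity of \<open>V(F)\<close>.\<close>

definition left_inverse_morphism ::
  "('a::field, 'v::finite) mpol \<Rightarrow> (('a, 'v) mpol ^ 'w::finite) set \<Rightarrow>
     (('a, 'w) mpol ^ 'v) set \<Rightarrow> bool" where
  "left_inverse_morphism F M N \<longleftrightarrow>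
     (\<forall>f\<in>M. \<forall>g\<in>N. \<forall>k l i j.
        vanishes_where F (f $ k * subst_pol f (g $ l))
          (subst_pol f (g $ i) * Var j - subst_pol f (g $ j) * Var i))"

definition isomorphic_hypersurfaces ::
  "('a::field, 'v::finite) mpol \<Rightarrow> ('a, 'w::finite) mpol \<Rightarrow> bool" where
  "isomorphic_hypersurfaces F G \<longleftrightarrow>
     (\<exists>M N. hypersurface_morphism F G M \<and> hypersurface_morphism G F N \<and>
            left_inverse_morphism F M N \<and> left_inverse_morphism G N M)"


section \<open>Inverses of rational parametrizations\<close>

text \<open>
  The tuple \<open>g\<close> represents the inverse of the rational map \<open>f\<close> from projective space to the irreducible
  hypersurface \<open>V(F)\<close>: both composites are defined generically and are the identity. Such a rational map takes
  the value p at x iff some representing tuple \<open>g\<close> has \<open>g(x) \<noteq> 0\<close> and \<open>p = [g(x)]\<close>.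
\<close>

definition represents_inverse ::
  "('a::field, 'v::finite) mpol \<Rightarrow> ('a, 'w::finite) mpol ^ 'v \<Rightarrow> ('a, 'v) mpol ^ 'w \<Rightarrow> bool" where
  "represents_inverse F f g \<longleftrightarrow>
     homogeneous_tuple g \<and>
     (\<exists>i. subst_pol f (g $ i) \<noteq> 0) \<and>
     (\<forall>i j. subst_pol f (g $ i) * Var j = subst_pol f (g $ j) * Var i) \<and>
     (\<exists>i. \<not> F dvd subst_pol g (f $ i)) \<and>
     (\<forall>i j. F dvd subst_pol g (f $ i) * Var j - subst_pol g (f $ j) * Var i)"

definition inverse_value ::
  "('a::field, 'v::finite) mpol \<Rightarrow> ('a, 'w::finite) mpol ^ 'v \<Rightarrow> 'a ^ 'v \<Rightarrow> 'a ^ 'w \<Rightarrow> bool" where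
  "inverse_value F f x p \<longleftrightarrow>
     p \<noteq> 0 \<and>
     (\<exists>g c. represents_inverse F f g \<and> c \<noteq> 0 \<and> p = c *s (\<chi> i. eval_pol x (g $ i)))"


section \<open>The Segre cubic, its parametrization, and the Weddle surface\<close>

definition reference_points :: "('a::field ^ 4) set" where
  "reference_points = {axis 0 1, axis 1 1, axis 2 1, axis 3 1, (\<chi> i. 1)}"

definition segre_cubic :: "('a::field, 5) mpol" where
  "segre_cubic =
     Var 1 * Var 2 * Var 4 - Var 0 * Var 3 * Var 4 - Var 1 * Var 2 * Var 3
     + Var 0 * Var 1 * Var 3 + Var 0 * Var 2 * Var 3 - Var 0 ^ 2 * Var 3"

definition segre_param :: "('a::field, 4) mpol ^ 5" where
  "segre_param = (\<chi> i.
     if i = 0 then Var 3 * (Var 0 + Var 1)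
     else if i = 1 then Var 3 * (Var 1 + Var 2)
     else if i = 2 then Var 2 * (Var 0 + Var 1)
     else if i = 3 then Var 2 * (Var 1 + Var 3)
     else (Var 0 + Var 2) * (Var 1 + Var 3))"

text \<open>Row i of the matrix is \<open>(p\<^sub>i \<Prod>\<^sub>k\<^sub>\<noteq>\<^sub>i t\<^sub>k, t\<^sub>i, 1, p\<^sub>i)\<close>.\<close>

definition weddle :: "'a::field ^ 4 \<Rightarrow> ('a, 4) mpol" where
  "weddle p = det (\<chi> i j :: 4.
     if j = 0 then Const (p $ i) * (\<Prod>k\<in>UNIV - {i}. Var k)
     else if j = 1 then Var i
     else if j = 2 then 1
     else Const (p $ i))"

end

theory Submission
  imports Defs
begin

text \<open>
  In characteristic 2 the preimage of the polar quadric with pole \<open>\<phi>(p)\<close> has, as a form in \<open>t\<close> and \<open>p\<close>,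
  the same equation as the Weddle surface of \<open>p\<^sub>1, \<dots>, p\<^sub>5, p\<close>. If \<open>p\<close> lies on no plane through three
  reference points, then \<open>\<phi>(p)\<close> is nonzero, so the composite of \<open>\<phi>\<close> with its inverse, which is the
  identity generically, gives \<open>x = \<mu> \<phi>(p)\<close> with \<open>\<mu> \<noteq> 0\<close>. The two quartic forms are therefore
  proportional, and the identity map is an isomorphism between the surfaces.
\<close>

section \<open>Decomposition into monomials, and evaluation at a point\<close>

lemma mpol_induct [case_names single add]:
  assumes "\<And>m c. P (Poly_Mapping.single m c)"
    and "\<And>p q. P p \<Longrightarrow> P q \<Longrightarrow> P (p + q)"
  shows "P (p :: ('a::comm_ring_1, 'v) mpol)"
proof (induction p rule: Poly_Mapping.update_induct)
  case const
  show ?case using assms(1)[of 0 0] by simp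
next
  case (update f a b)
  \<comment> \<open>The key \<open>a\<close> is fresh, so setting its value amounts to adding a
    monomial.\<close>
  have "Poly_Mapping.update a b f = f + Poly_Mapping.single a b"
    using update.hyps(1)
    by (intro poly_mapping_eqI)
       (auto simp: lookup_update lookup_add lookup_single when_def in_keys_iff)
  then show ?case using assms update.IH by simp
qed

text \<open>A zero coefficient leaves no keys and hence an empty sum; the assumption on
  \<open>f\<close> reconciles this case with the others.\<close>

lemma sum_keys_single:
  assumes "\<And>k. f k 0 = 0"
  shows "(\<Sum>m\<in>Poly_Mapping.keys (Poly_Mapping.single k c).
            f m (Poly_Mapping.lookup (Poly_Mapping.single k c) m)) = f k c"
  using assms by (cases "c = 0") simp_all

text \<open>Cancellation may remove keys from \<open>p + q\<close>. This does no harm, since the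
  summand is additive in the coefficient and vanishes at coefficient 0.\<close>

lemma eval_pol_add: "eval_pol x (p + q) = eval_pol x p + eval_pol x q"
  unfolding eval_pol_def
  by (rule setsum_keys_plus_distrib) (simp_all add: distrib_right)

lemma eval_pol_single:
  "eval_pol x (Poly_Mapping.single m c) = c * (\<Prod>v\<in>UNIV. (x $ v) ^ Poly_Mapping.lookup m v)"
  unfolding eval_pol_def by (rule sum_keys_single) simp

text \<open>Both sides are additive in each factor, so the nested inductions leave a product of two
  monomials, where exponents add.\<close>

lemma eval_pol_mult: "eval_pol x (p * q) = eval_pol x p * eval_pol x q"
proof (induction p rule: mpol_induct)
  case (single m c)
  show ?case
  proof (induction q rule: mpol_induct)
    case (single n d)
    show ?case
      by (simp add: mult_single eval_pol_single lookup_add power_add prod.distrib ac_simps)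
  qed (simp add: eval_pol_add distrib_left)
qed (simp add: eval_pol_add distrib_right)

lemma eval_pol_uminus: "eval_pol x (- p) = - eval_pol x p"
  using eval_pol_add[of x p "- p"] by (simp add: eval_pol_def add_eq_0_iff)

lemma eval_pol_diff: "eval_pol x (p - q) = eval_pol x p - eval_pol x q"
  using eval_pol_add[of x p "- q"] by (simp add: eval_pol_uminus)

lemma prod_power_single:
  fixes f :: "'v::finite \<Rightarrow> 'b::comm_monoid_mult"
  shows "(\<Prod>w\<in>UNIV. f w ^ Poly_Mapping.lookup (Poly_Mapping.single v n) w) = f v ^ n"
proof -
  have "(\<Prod>w\<in>UNIV. f w ^ Poly_Mapping.lookup (Poly_Mapping.single v n) w)
      = (\<Prod>w\<in>UNIV. if w = v then f v ^ n else 1)"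
    by (intro prod.cong) (auto simp: lookup_single when_def)
  then show ?thesis by simp
qed

lemma eval_pol_Var: "eval_pol x (Var v) = x $ v"
  by (simp add: Var_def eval_pol_single prod_power_single)

lemma Const_add: "Const (a + b) = Const a + Const b"
  by (simp add: Const_def single_add)

lemma Const_mult: "Const (a * b) = Const a * Const b"
  by (simp add: Const_def mult_single)

lemma Const_0: "Const 0 = 0"
  by (simp add: Const_def)

lemma Const_1: "Const 1 = 1"
  by (simp add: Const_def)

lemma eval_pol_Const: "eval_pol x (Const c) = c"
  by (simp add: Const_def eval_pol_single)

lemma eval_pol_1: "eval_pol x 1 = 1"
  using eval_pol_Const[of x 1] by (simp add: Const_1)

lemma eval_pol_power: "eval_pol x (p ^ n) = eval_pol x p ^ n"
  by (induction n) (simp_all add: eval_pol_1 eval_pol_mult)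

lemma eval_pol_prod: "eval_pol x (\<Prod>i\<in>A. f i) = (\<Prod>i\<in>A. eval_pol x (f i))"
  by (induction A rule: infinite_finite_induct) (simp_all add: eval_pol_1 eval_pol_mult)

section \<open>Substitution of polynomials\<close>

lemma subst_pol_add: "subst_pol f (p + q) = subst_pol f p + subst_pol f q"
  unfolding subst_pol_def
  by (rule setsum_keys_plus_distrib) (simp_all add: distrib_right Const_add Const_0)

lemma subst_pol_single:
  "subst_pol f (Poly_Mapping.single m c)
     = Const c * (\<Prod>w\<in>UNIV. (f $ w) ^ Poly_Mapping.lookup m w)"
  unfolding subst_pol_def by (rule sum_keys_single) (simp add: Const_0)

lemma subst_pol_mult: "subst_pol f (p * q) = subst_pol f p * subst_pol f q"
proof (induction p rule: mpol_induct)
  case (single m c)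
  show ?case
  proof (induction q rule: mpol_induct)
    case (single n d)
    show ?case
      by (simp add: mult_single subst_pol_single lookup_add power_add prod.distrib Const_mult
          ac_simps)
  qed (simp add: subst_pol_add distrib_left)
qed (simp add: subst_pol_add distrib_right)

text \<open>Lets a polynomial identity for a composite of rational maps be read off at a single
  point.\<close>

lemma eval_pol_subst_pol:
  "eval_pol x (subst_pol f p) = eval_pol (\<chi> w. eval_pol x (f $ w)) p"
proof (induction p rule: mpol_induct)
  case (single m c)
  show ?case
    by (simp add: subst_pol_single eval_pol_single eval_pol_mult eval_pol_Const eval_pol_prod
        eval_pol_power)
qed (simp add: subst_pol_add eval_pol_add)

lemma subst_pol_0: "subst_pol f 0 = 0"
  by (simp add: subst_pol_def)

lemma subst_pol_uminus: "subst_pol f (- p) = - subst_pol f p"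
  using subst_pol_add[of f p "- p"] by (simp add: subst_pol_0 add_eq_0_iff)

lemma subst_pol_diff: "subst_pol f (p - q) = subst_pol f p - subst_pol f q"
  using subst_pol_add[of f p "- q"] by (simp add: subst_pol_uminus)

lemma subst_pol_Const: "subst_pol f (Const c) = Const c"
  using subst_pol_single[of f 0 c] by (simp add: Const_def)

lemma subst_pol_Var: "subst_pol f (Var v) = f $ v"
  by (simp add: Var_def subst_pol_single prod_power_single Const_1)

text \<open>Reassembles a monomial from powers of its variables, as needed to see that substituting
  the variables for themselves changes nothing.\<close>

lemma prod_Var_power:
  "(\<Prod>v\<in>A. Var v ^ Poly_Mapping.lookup m v)
     = (Poly_Mapping.single (\<Sum>v\<in>A. Poly_Mapping.single v (Poly_Mapping.lookup m v)) 1
          :: ('a::comm_ring_1, 'v) mpol)"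
proof (induction A rule: infinite_finite_induct)
  case (insert v A)
  have "(Var v :: ('a, 'v) mpol) ^ n = Poly_Mapping.single (Poly_Mapping.single v n) 1" for n
    by (induction n) (simp_all add: Var_def mult_single single_add[symmetric])
  then show ?case using insert by (simp add: mult_single)
qed simp_all

lemma sum_single_lookup:
  fixes m :: "'v::finite \<Rightarrow>\<^sub>0 nat"
  shows "(\<Sum>v\<in>UNIV. Poly_Mapping.single v (Poly_Mapping.lookup m v)) = m"
  by (intro poly_mapping_eqI) (simp add: lookup_sum lookup_single when_def)

lemma subst_pol_Vars: "subst_pol (\<chi> v. Var v) p = p"
proof (induction p rule: mpol_induct)
  case (single m c)
  show ?case
    by (simp add: subst_pol_single prod_Var_power sum_single_lookup Const_def mult_single)
qed (simp add: subst_pol_add)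

section \<open>Formal partial derivatives\<close>

lemma partial_deriv_add: "partial_deriv v (p + q) = partial_deriv v p + partial_deriv v q"
  unfolding partial_deriv_def
  by (rule setsum_keys_plus_distrib) (simp_all add: distrib_left single_add)

lemma partial_deriv_single:
  "partial_deriv v (Poly_Mapping.single m c)
     = Poly_Mapping.single (m - Poly_Mapping.single v 1) (of_nat (Poly_Mapping.lookup m v) * c)"
  unfolding partial_deriv_def by (rule sum_keys_single) simp

lemma partial_deriv_uminus: "partial_deriv v (- p) = - partial_deriv v p"
  using partial_deriv_add[of v p "- p"] by (simp add: partial_deriv_def add_eq_0_iff)

lemma partial_deriv_diff: "partial_deriv v (p - q) = partial_deriv v p - partial_deriv v q"
  using partial_deriv_add[of v p "- q"] by (simp add: partial_deriv_uminus)

text \<open>Subtraction of exponents is truncated at 0; the assumption ensures that the unit is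
  taken from \<open>m\<close> on both sides.\<close>

lemma minus_single_add:
  fixes m n :: "'v \<Rightarrow>\<^sub>0 nat"
  assumes "Poly_Mapping.lookup m v \<noteq> 0"
  shows "m + n - Poly_Mapping.single v 1 = (m - Poly_Mapping.single v 1) + n"
  using assms
  by (intro poly_mapping_eqI) (auto simp: lookup_add lookup_minus lookup_single when_def)

lemma partial_deriv_mult:
  "partial_deriv v (p * q) = partial_deriv v p * q + p * partial_deriv v q"
proof (induction p rule: mpol_induct)
  case (single m c)
  show ?case
  proof (induction q rule: mpol_induct)
    case (single n d)
    let ?e = "Poly_Mapping.single v (1::nat)"
    \<comment> \<open>If \<open>v\<close> does not occur in \<open>m\<close>, the exponents may
      differ, but the coefficient is 0 and both monomials vanish.\<close>
    have m: "Poly_Mapping.single (m - ?e + n) (of_nat (Poly_Mapping.lookup m v) * c * d)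
        = Poly_Mapping.single (m + n - ?e) (of_nat (Poly_Mapping.lookup m v) * c * d)"
      by (cases "Poly_Mapping.lookup m v = 0") (simp_all add: minus_single_add[simplified])
    have n: "Poly_Mapping.single (m + (n - ?e)) (c * (of_nat (Poly_Mapping.lookup n v) * d))
        = Poly_Mapping.single (m + n - ?e) (c * (of_nat (Poly_Mapping.lookup n v) * d))"
      using minus_single_add[of n v m]
      by (cases "Poly_Mapping.lookup n v = 0") (simp_all add: add.commute)
    show ?case
      unfolding mult_single partial_deriv_single m n single_add[symmetric]
      by (simp add: lookup_add algebra_simps)
  qed (simp add: partial_deriv_add algebra_simps)
qed (simp add: partial_deriv_add algebra_simps)

lemma partial_deriv_Var: "partial_deriv v (Var w) = (if v = w then 1 else 0)"
  by (simp add: Var_def partial_deriv_single lookup_single)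

section \<open>Proportional equations define isomorphic hypersurfaces\<close>

lemma Const_mult_dvd_iff:
  fixes c :: "'a::field"
  assumes "c \<noteq> 0"
  shows "Const c * p dvd q \<longleftrightarrow> p dvd q"
proof -
  have "p = Const (inverse c) * (Const c * p)"
    using assms by (simp add: Const_1 flip: mult.assoc Const_mult)
  then have "Const c * p dvd p" by (metis dvd_triv_right)
  then show ?thesis by (metis dvd_trans dvd_triv_right)
qed

text \<open>The coordinate tuple serves in both directions. Substituting it returns the target form,
  which the source form divides because a nonzero constant is a unit; the remaining compatibility
  conditions concern differences that are 0.\<close>

lemma isomorphic_hypersurfaces_Const_mult:
  fixes G :: "('a::field, 'v::finite) mpol"
  assumes "c \<noteq> 0"
  shows "isomorphic_hypersurfaces (Const c * G) G"
proof -
  define M :: "(('a, 'v) mpol ^ 'v) set" where "M = {\<chi> v. Var v}"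
  have tuple: "homogeneous_tuple ((\<chi> v. Var v) :: ('a, 'v) mpol ^ 'v)"
    unfolding homogeneous_tuple_def homogeneous_def Var_def
    by (rule exI[of _ 1]) (simp add: lookup_single when_def)
  have *: "hypersurface_morphism F F' M \<and> left_inverse_morphism F M M"
    if "F dvd F'" for F F' :: "('a, 'v) mpol"
    using that tuple
    by (auto simp: M_def hypersurface_morphism_def left_inverse_morphism_def vanishes_where_def
        subst_pol_Vars eval_pol_Var subst_pol_Var vec_eq_iff[of _ 0] algebra_simps)
  show ?thesis
    unfolding isomorphic_hypersurfaces_def
    using *[of "Const c * G" G] *[of G "Const c * G"] assms by (auto simp: Const_mult_dvd_iff)
qed

section \<open>Explicit index sets and the determinant of size four\<close>

lemma UNIV_index4: "UNIV = {0, 1, 2, 3 :: 4}"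
proof -
  have "x \<in> {0, 1, 2, 3}" for x :: 4
  proof (induct x)
    case (of_int z)
    then have "z = 0 \<or> z = 1 \<or> z = 2 \<or> z = 3" by fastforce
    then show ?case by auto
  qed
  then show ?thesis by auto
qed

lemma UNIV_index5: "UNIV = {0, 1, 2, 3, 4 :: 5}"
proof -
  have "x \<in> {0, 1, 2, 3, 4}" for x :: 5
  proof (induct x)
    case (of_int z)
    then have "z = 0 \<or> z = 1 \<or> z = 2 \<or> z = 3 \<or> z = 4" by fastforce
    then show ?case by auto
  qed
  then show ?thesis by auto
qed

lemma forall_index4: "(\<forall>i::4. P i) \<longleftrightarrow> P 0 \<and> P 1 \<and> P 2 \<and> P 3"
proof -
  have "(\<forall>i::4. P i) \<longleftrightarrow> (\<forall>i\<in>{0, 1, 2, 3}. P i)"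
    by (metis UNIV_I UNIV_index4)
  then show ?thesis by simp
qed

text \<open>The permutations are enumerated by adjoining one index at a time through a
  transposition, which yields the 24 signed terms.\<close>

lemma det_index4:
  fixes A :: "'a::comm_ring_1 ^ 4 ^ 4"
  shows "det A =
    A $ 0 $ 0 * A $ 1 $ 1 * A $ 2 $ 2 * A $ 3 $ 3
    - A $ 0 $ 0 * A $ 1 $ 1 * A $ 2 $ 3 * A $ 3 $ 2
    - A $ 0 $ 0 * A $ 1 $ 2 * A $ 2 $ 1 * A $ 3 $ 3
    + A $ 0 $ 0 * A $ 1 $ 2 * A $ 2 $ 3 * A $ 3 $ 1
    + A $ 0 $ 0 * A $ 1 $ 3 * A $ 2 $ 1 * A $ 3 $ 2
    - A $ 0 $ 0 * A $ 1 $ 3 * A $ 2 $ 2 * A $ 3 $ 1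
    - A $ 0 $ 1 * A $ 1 $ 0 * A $ 2 $ 2 * A $ 3 $ 3
    + A $ 0 $ 1 * A $ 1 $ 0 * A $ 2 $ 3 * A $ 3 $ 2
    + A $ 0 $ 1 * A $ 1 $ 2 * A $ 2 $ 0 * A $ 3 $ 3
    - A $ 0 $ 1 * A $ 1 $ 2 * A $ 2 $ 3 * A $ 3 $ 0
    - A $ 0 $ 1 * A $ 1 $ 3 * A $ 2 $ 0 * A $ 3 $ 2
    + A $ 0 $ 1 * A $ 1 $ 3 * A $ 2 $ 2 * A $ 3 $ 0
    + A $ 0 $ 2 * A $ 1 $ 0 * A $ 2 $ 1 * A $ 3 $ 3
    - A $ 0 $ 2 * A $ 1 $ 0 * A $ 2 $ 3 * A $ 3 $ 1
    - A $ 0 $ 2 * A $ 1 $ 1 * A $ 2 $ 0 * A $ 3 $ 3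
    + A $ 0 $ 2 * A $ 1 $ 1 * A $ 2 $ 3 * A $ 3 $ 0
    + A $ 0 $ 2 * A $ 1 $ 3 * A $ 2 $ 0 * A $ 3 $ 1
    - A $ 0 $ 2 * A $ 1 $ 3 * A $ 2 $ 1 * A $ 3 $ 0
    - A $ 0 $ 3 * A $ 1 $ 0 * A $ 2 $ 1 * A $ 3 $ 2
    + A $ 0 $ 3 * A $ 1 $ 0 * A $ 2 $ 2 * A $ 3 $ 1
    + A $ 0 $ 3 * A $ 1 $ 1 * A $ 2 $ 0 * A $ 3 $ 2
    - A $ 0 $ 3 * A $ 1 $ 1 * A $ 2 $ 2 * A $ 3 $ 0
    - A $ 0 $ 3 * A $ 1 $ 2 * A $ 2 $ 0 * A $ 3 $ 1
    + A $ 0 $ 3 * A $ 1 $ 2 * A $ 2 $ 1 * A $ 3 $ 0"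
proof -
  have f0: "finite {1::4, 2, 3}" "0 \<notin> {1::4, 2, 3}" by auto
  have f1: "finite {2::4, 3}" "1 \<notin> {2::4, 3}" by auto
  have f2: "finite {3::4}" "2 \<notin> {3::4}" by auto
  show ?thesis
    unfolding det_def UNIV_index4
    unfolding sum_over_permutations_insert[OF f0]
    unfolding sum_over_permutations_insert[OF f1]
    unfolding sum_over_permutations_insert[OF f2]
    unfolding permutes_sing
    by (simp add: sign_swap_id permutation_swap_id permutation_compose sign_compose swap_id_eq
        algebra_simps)
qed

lemma index4_Diff_singleton:
  "UNIV - {0 :: 4} = {1, 2, 3}" "UNIV - {1 :: 4} = {0, 2, 3}"
  "UNIV - {2 :: 4} = {0, 1, 3}" "UNIV - {3 :: 4} = {0, 1, 2}"
  unfolding UNIV_index4 by auto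

section \<open>The polar quadric and the Weddle quartic in coordinates\<close>

lemma subst_polar_segre_cubic:
  fixes x :: "'a::field ^ 5"
  shows "subst_pol f (polar segre_cubic x) =
     Const (x $ 0) * (f $ 1 * f $ 3 + f $ 2 * f $ 3 - f $ 3 * f $ 4 - f $ 0 * f $ 3 - f $ 0 * f $ 3)
     + Const (x $ 1) * (f $ 2 * f $ 4 - f $ 2 * f $ 3 + f $ 0 * f $ 3)
     + Const (x $ 2) * (f $ 1 * f $ 4 - f $ 1 * f $ 3 + f $ 0 * f $ 3)
     + Const (x $ 3) * (f $ 0 * f $ 1 + f $ 0 * f $ 2 - f $ 0 * f $ 4 - f $ 1 * f $ 2
         - f $ 0 * f $ 0)
     + Const (x $ 4) * (f $ 1 * f $ 2 - f $ 0 * f $ 3)"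
proof -
  let ?d = "\<lambda>v. partial_deriv v segre_cubic :: ('a, 5) mpol"
  have d: "?d 0 = Var 1 * Var 3 + Var 2 * Var 3 - Var 3 * Var 4 - Var 0 * Var 3 - Var 0 * Var 3"
    "?d 1 = Var 2 * Var 4 - Var 2 * Var 3 + Var 0 * Var 3"
    "?d 2 = Var 1 * Var 4 - Var 1 * Var 3 + Var 0 * Var 3"
    "?d 3 = Var 0 * Var 1 + Var 0 * Var 2 - Var 0 * Var 4 - Var 1 * Var 2 - Var 0 * Var 0"
    "?d 4 = Var 1 * Var 2 - Var 0 * Var 3"
    by (simp_all add: segre_cubic_def power2_eq_square partial_deriv_add partial_deriv_diff
        partial_deriv_mult partial_deriv_Var)
  \<comment> \<open>Simplification may merge the two equal terms of \<open>?d 0\<close> into a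
    multiple of the numeral 2, a constant that substitution fixes.\<close>
  have 2: "subst_pol f 2 = 2"
    using subst_pol_Const[of f 2] by (simp add: Const_def)
  show ?thesis
    unfolding polar_def UNIV_index5
    by (simp add: d 2 subst_pol_add subst_pol_diff subst_pol_mult subst_pol_Const
        subst_pol_Var)
qed

text \<open>Cofactor expansion along the first column; each bracket is a minor with rows
  \<open>(t\<^sub>i, 1, p\<^sub>i)\<close>.\<close>

lemma weddle_eq:
  "weddle p =
     Const (p $ 0) * Var 1 * Var 2 * Var 3 * (Var 1 * (Const (p $ 3) - Const (p $ 2))
         + Var 2 * (Const (p $ 1) - Const (p $ 3)) + Var 3 * (Const (p $ 2) - Const (p $ 1)))
     - Const (p $ 1) * Var 0 * Var 2 * Var 3 * (Var 0 * (Const (p $ 3) - Const (p $ 2))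
         + Var 2 * (Const (p $ 0) - Const (p $ 3)) + Var 3 * (Const (p $ 2) - Const (p $ 0)))
     + Const (p $ 2) * Var 0 * Var 1 * Var 3 * (Var 0 * (Const (p $ 3) - Const (p $ 1))
         + Var 1 * (Const (p $ 0) - Const (p $ 3)) + Var 3 * (Const (p $ 1) - Const (p $ 0)))
     - Const (p $ 3) * Var 0 * Var 1 * Var 2 * (Var 0 * (Const (p $ 2) - Const (p $ 1))
         + Var 1 * (Const (p $ 0) - Const (p $ 2)) + Var 2 * (Const (p $ 1) - Const (p $ 0)))"
  by (simp add: weddle_def det_index4 index4_Diff_singleton algebra_simps)

text \<open>
  The two forms have integral coefficients and agree modulo 2. Keeping their difference explicit
  makes this a ring identity, decided by expansion.
\<close>

lemma polar_weddle_identity: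
  fixes t0 t1 t2 t3 p0 p1 p2 p3 y0 y1 y2 y3 y4 :: "'a::comm_ring_1"
  assumes "y0 = t3 * (t0 + t1)"
    and "y1 = t3 * (t1 + t2)"
    and "y2 = t2 * (t0 + t1)"
    and "y3 = t2 * (t1 + t3)"
    and "y4 = (t0 + t2) * (t1 + t3)"
  shows "(p3 * (p0 + p1)) * (y1 * y3 + y2 * y3 - y3 * y4 - y0 * y3 - y0 * y3)
     + (p3 * (p1 + p2)) * (y2 * y4 - y2 * y3 + y0 * y3)
     + (p2 * (p0 + p1)) * (y1 * y4 - y1 * y3 + y0 * y3)
     + (p2 * (p1 + p3)) * (y0 * y1 + y0 * y2 - y0 * y4 - y1 * y2 - y0 * y0)
     + ((p0 + p2) * (p1 + p3)) * (y1 * y2 - y0 * y3) =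
     p0 * t1 * t2 * t3 * (t1 * (p3 - p2) + t2 * (p1 - p3) + t3 * (p2 - p1))
     - p1 * t0 * t2 * t3 * (t0 * (p3 - p2) + t2 * (p0 - p3) + t3 * (p2 - p0))
     + p2 * t0 * t1 * t3 * (t0 * (p3 - p1) + t1 * (p0 - p3) + t3 * (p1 - p0))
     - p3 * t0 * t1 * t2 * (t0 * (p2 - p1) + t1 * (p0 - p2) + t2 * (p1 - p0))
     + 2 * (t0 * t2 * t2 * t3 * p0 * p3 + t0 * t1 * t2 * t2 * p1 * p3 + t0 * t0 * t2 * t3 * p1 * p3
         + t0 * t0 * t1 * t2 * p2 * p3 + t0 * t0 * t2 * t3 * p2 * p3 + t0 * t1 * t2 * t3 * p2 * p3
         + t0 * t1 * t3 * t3 * p0 * p2 + t0 * t1 * t2 * t3 * p0 * p2 + t0 * t2 * t3 * t3 * p0 * p2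
         + t1 * t1 * t2 * t3 * p0 * p2 + t0 * t1 * t2 * t3 * p1 * p2 + t0 * t2 * t3 * t3 * p1 * p2
         + t0 * t2 * t2 * t3 * p0 * p1 + t1 * t2 * t2 * t3 * p0 * p3 - t1 * t1 * t2 * t3 * p0 * p3
         - t1 * t2 * t3 * t3 * p0 * p3 - t0 * t1 * t2 * t3 * p1 * p3 - t0 * t2 * t3 * t3 * p1 * p3
         - t0 * t1 * t3 * t3 * p1 * p2 - t0 * t0 * t3 * t3 * p1 * p2 - t0 * t0 * t1 * t3 * p2 * p3
         - t0 * t0 * t3 * t3 * p2 * p3 - t0 * t1 * t3 * t3 * p2 * p3 - t0 * t2 * t3 * t3 * p0 * p1
         - 2 * t0 * t1 * t2 * t3 * p0 * p3 - 2 * t0 * t2 * t3 * t3 * p0 * p3)"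
  unfolding assms by (simp add: algebra_simps)

text \<open>The polar is linear in its pole, so the scalar \<open>c\<close> factors out. What
  remains is the identity modulo 2, applied in the polynomial ring with the variables as
  \<open>t\<close> and constants as \<open>p\<close>.\<close>

lemma subst_polar_eq_weddle:
  fixes p :: "'k::field ^ 4"
  assumes "CHAR('k) = 2" and x: "x = (\<chi> i. c * eval_pol p (segre_param $ i))"
  shows "subst_pol segre_param (polar segre_cubic x) = Const c * weddle p"
proof -
  have "(2 :: 'k) = 0"
    using assms(1) of_nat_CHAR[where ?'a = 'k] by simp
  then have two: "(2 :: ('k, 4) mpol) = 0"
    by (metis single_numeral single_zero)
  let ?y = "\<lambda>i. segre_param $ i :: ('k, 4) mpol"
  have y: "?y 0 = Var 3 * (Var 0 + Var 1)" "?y 1 = Var 3 * (Var 1 + Var 2)"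
    "?y 2 = Var 2 * (Var 0 + Var 1)" "?y 3 = Var 2 * (Var 1 + Var 3)"
    "?y 4 = (Var 0 + Var 2) * (Var 1 + Var 3)"
    by (simp_all add: segre_param_def)
  \<comment> \<open>The coordinates of the pole become constant polynomials, so that pole and
    variables lie in one ring and match the shape of \<open>polar_weddle_identity\<close>.\<close>
  let ?e = "\<lambda>i. Const (eval_pol p (segre_param $ i)) :: ('k, 4) mpol"
  have e: "?e 0 = Const (p $ 3) * (Const (p $ 0) + Const (p $ 1))"
    "?e 1 = Const (p $ 3) * (Const (p $ 1) + Const (p $ 2))"
    "?e 2 = Const (p $ 2) * (Const (p $ 0) + Const (p $ 1))"
    "?e 3 = Const (p $ 2) * (Const (p $ 1) + Const (p $ 3))"
    "?e 4 = (Const (p $ 0) + Const (p $ 2)) * (Const (p $ 1) + Const (p $ 3))"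
    by (simp_all add: segre_param_def eval_pol_mult eval_pol_add eval_pol_Var Const_mult Const_add)
  have "subst_pol segre_param (polar segre_cubic x) = Const c *
    (?e 0 * (?y 1 * ?y 3 + ?y 2 * ?y 3 - ?y 3 * ?y 4 - ?y 0 * ?y 3 - ?y 0 * ?y 3)
     + ?e 1 * (?y 2 * ?y 4 - ?y 2 * ?y 3 + ?y 0 * ?y 3)
     + ?e 2 * (?y 1 * ?y 4 - ?y 1 * ?y 3 + ?y 0 * ?y 3)
     + ?e 3 * (?y 0 * ?y 1 + ?y 0 * ?y 2 - ?y 0 * ?y 4 - ?y 1 * ?y 2 - ?y 0 * ?y 0)
     + ?e 4 * (?y 1 * ?y 2 - ?y 0 * ?y 3))"
    unfolding subst_polar_segre_cubic by (simp add: x Const_mult distrib_left mult.assoc)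
  also have "\<dots> = Const c * weddle p"
    unfolding e polar_weddle_identity[OF y] weddle_eq by (simp add: two)
  finally show ?thesis .
qed

section \<open>Recovering the pole from its preimage\<close>

lemma eval_segre_param_scale:
  "eval_pol (c *s p) (segre_param $ i) = c\<^sup>2 * eval_pol p (segre_param $ i)"
  by (simp add: segre_param_def eval_pol_mult eval_pol_add eval_pol_Var power2_eq_square
      algebra_simps)

text \<open>That the parametrization after its inverse is the identity is a divisibility by the
  cubic form, so it can be evaluated at every point of the cubic. The scalar relating
  \<open>p\<close> to \<open>g(x)\<close> enters both sides as the same square.\<close>

lemma segre_param_proportional:
  fixes x :: "'k::field ^ 5"
  assumes "inverse_value segre_cubic segre_param x p" "eval_pol x segre_cubic = 0"
  shows "eval_pol p (segre_param $ i) * x $ j = eval_pol p (segre_param $ j) * x $ i"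
proof -
  obtain g :: "('k, 5) mpol ^ 4" and c where
    g: "represents_inverse segre_cubic segre_param g" and p: "p = c *s (\<chi> i. eval_pol x (g $ i))"
    using assms(1) unfolding inverse_value_def by blast
  have "segre_cubic dvd
      subst_pol g (segre_param $ i) * Var j - subst_pol g (segre_param $ j) * Var i"
    using g unfolding represents_inverse_def by blast
  then have "eval_pol x (subst_pol g (segre_param $ i) * Var j
      - subst_pol g (segre_param $ j) * Var i) = 0"
    using assms(2) by (auto simp: eval_pol_mult)
  then show ?thesis
    by (simp add: p eval_segre_param_scale eval_pol_diff eval_pol_mult eval_pol_Var
        eval_pol_subst_pol)
qed

text \<open>The plane through the first three reference points is \<open>t\<^sub>3 = 0\<close>, and
  the one through the last three is \<open>t\<^sub>0 = t\<^sub>1\<close>. In characteristic 2 these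
  are the zeros of the first coordinate \<open>t\<^sub>3 (t\<^sub>0 + t\<^sub>1)\<close> of the
  parametrization.\<close>

lemma reference_plane_coordinates:
  fixes p :: "'k::field ^ 4"
  assumes "\<forall>T. T \<subseteq> reference_points \<and> card T = 3 \<longrightarrow> p \<notin> vec.span T"
  shows "p $ 3 \<noteq> 0" and "p $ 0 \<noteq> p $ 1"
proof -
  have "p \<in> vec.span {axis 0 1, axis 1 1, axis 2 1}" if "p $ 3 = 0"
  proof -
    have "p = p $ 0 *s axis 0 1 + p $ 1 *s axis 1 1 + p $ 2 *s axis 2 1"
      using that by (simp add: vec_eq_iff forall_index4 axis_def)
    then show ?thesis
      by (rule ssubst) (intro vec.span_add vec.span_scale vec.span_base; simp)
  qed
  moreover have "{axis 0 1, axis 1 1, axis 2 1 :: 'k ^ 4} \<subseteq> reference_points"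
    by (simp add: reference_points_def)
  moreover have "card {axis 0 1, axis 1 1, axis 2 1 :: 'k ^ 4} = 3"
    by (simp add: axis_eq_axis)
  ultimately show "p $ 3 \<noteq> 0"
    using assms by blast
  have "p \<in> vec.span {axis 2 1, axis 3 1, \<chi> i. 1}" if "p $ 0 = p $ 1"
  proof -
    \<comment> \<open>Subtracting \<open>p $ 0\<close> times the all-ones point clears coordinates 0
      and 1 together.\<close>
    have "p = (p $ 2 - p $ 0) *s axis 2 1 + (p $ 3 - p $ 0) *s axis 3 1 + p $ 0 *s (\<chi> i. 1)"
      using that by (simp add: vec_eq_iff forall_index4 axis_def)
    then show ?thesis
      by (rule ssubst) (intro vec.span_add vec.span_scale vec.span_base; simp)
  qed
  moreover have "{axis 2 1, axis 3 1, (\<chi> i. 1) :: 'k ^ 4} \<subseteq> reference_points"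
    by (simp add: reference_points_def)
  moreover have "card {axis 2 1, axis 3 1, (\<chi> i. 1) :: 'k ^ 4} = 3"
    by (simp add: axis_eq_axis vec_eq_iff forall_index4 axis_def)
  ultimately show "p $ 0 \<noteq> p $ 1"
    using assms by blast
qed

theorem theorem3p1:
  fixes x :: "'k::alg_closed_field ^ 5" and p\<^sub>6 :: "'k ^ 4"
  assumes "CHAR('k) = 2"
    and "nonsingular_point segre_cubic x"
    and "inverse_value segre_cubic segre_param x p\<^sub>6"
    and "\<forall>T. T \<subseteq> reference_points \<and> card T = 3 \<longrightarrow> p\<^sub>6 \<notin> vec.span T"
  shows "isomorphic_hypersurfaces (subst_pol segre_param (polar segre_cubic x)) (weddle p\<^sub>6)"
proof -
  define y where "y i = eval_pol p\<^sub>6 (segre_param $ i)" for i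
  have "(2 :: 'k) = 0"
    using assms(1) of_nat_CHAR[where ?'a = 'k] by simp
  then have "a + b = 0 \<longleftrightarrow> a = b" for a b :: 'k
    by (metis add_eq_0_iff2 mult_2 mult_zero_left)
  then have y0: "y 0 \<noteq> 0"
    using reference_plane_coordinates[OF assms(4)]
    by (simp add: y_def segre_param_def eval_pol_mult eval_pol_add eval_pol_Var)
  have proportional: "y i * x $ j = y j * x $ i" for i j
    using segre_param_proportional assms(2,3) by (auto simp: y_def nonsingular_point_def)
  \<comment> \<open>Needed for the factor \<open>x $ 0 / y 0\<close> between the two quartics to be
    a unit; since \<open>y 0\<close> is nonzero, all of \<open>x\<close> would vanish with
    \<open>x $ 0\<close>.\<close>
  have x0: "x $ 0 \<noteq> 0"
  proof
    assume "x $ 0 = 0"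
    then have "x $ j = 0" for j using proportional[of 0 j] y0 by simp
    then show False using assms(2) by (simp add: nonsingular_point_def vec_eq_iff)
  qed
  have "x = (\<chi> i. (x $ 0 / y 0) * y i)"
    using proportional[of 0] y0 by (simp add: vec_eq_iff field_simps)
  then have "subst_pol segre_param (polar segre_cubic x) = Const (x $ 0 / y 0) * weddle p\<^sub>6"
    using subst_polar_eq_weddle[OF assms(1)] unfolding y_def by blast
  then show ?thesis
    using isomorphic_hypersurfaces_Const_mult[of "x $ 0 / y 0"] x0 y0 by simp
qed

end
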